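(* Let $m=2^k$ for some $k\in\mathbb{N}$, and suppose that $\mu(n,m-1)=U(n,m-1)$ for all $n\in\mathbb{N}$. Then $\mu(n,p)=U(n,p)$ for all $n\in\mathbb{N}$ and for both $p=m$ and $p=m+1$. In particular, $\mu(n,m)=\mu(n,m+1)$ for all $n\in\mathbb{N}$.
   Context: $\mathbb{F}_2$ is the field with two elements. For $u\in\mathbb{F}_2^n$, $|u|$ is the number of entries of $u$ equal to $1$. For an $n\times n$ matrix $W$ over $\mathbb{F}_2$, $M(W,0)=\max\{|Wx| : x\in\mathbb{F}_2^n\}$. For $n,m\ge 1$, $A(n,m)$ is the set of $n\times n$ matrices over $\mathbb{F}_2$ with all diagonal entries $1$ and every column containing at most $m$ ones, and $\mu(n,m)=\min\{M(W,0):W\in A(n,m)\}$. The sequence $(a(n))_{n\ge1}$ is defined by $a(1)=1$; $a(2^j-1+i)=2^{j-1}+a(i)$ for $1\le i\le 2^j-1$, $j\in\mathbb{N}$; and $a(2^{j+1}-1)=2^j$ for $j\in\mathbb{N}$. For $n,m\in\mathbb{N}$, let $j\ge0$ be the integer with $2^j\le m<2^{j+1}$, and let $q\ge 0$ and $1\le r\le 2^{j+1}-1$ be the integers with $n=(2^{j+1}-1)q+r$; then $U(n,m)=q2^j+a(r)$. *)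

theory Defs
  imports
    "HOL-Library.Z2"
    "HOL-Library.Discrete_Functions"
    "HOL-Library.FuncSet"
    "Jordan_Normal_Form.Matrix"
begin

definition weight :: "bit vec \<Rightarrow> nat"
  where "weight u = card {i. i < dim_vec u \<and> u $ i = 1}"

text \<open>The quantity written \<open>M(W, 0)\<close> in the paper.\<close>

definition max_weight :: "bit mat \<Rightarrow> nat"
  where "max_weight W = Max {weight (W *\<^sub>v x) | x. x \<in> carrier_vec (dim_col W)}"

definition A_mats :: "nat \<Rightarrow> nat \<Rightarrow> bit mat set"
  where "A_mats n m = {W \<in> carrier_mat n n.
           (\<forall>i<n. W $$ (i, i) = 1) \<and> (\<forall>j<n. weight (col W j) \<le> m)}"

definition mu :: "nat \<Rightarrow> nat \<Rightarrow> nat"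
  where "mu n m = Min {max_weight W | W. W \<in> A_mats n m}"

text \<open>The sets whose maximum and minimum are taken above are finite, and they are nonempty
  (for \<open>m \<ge> 1\<close> in the second case).\<close>

lemma finite_UNIV_bit: "finite (UNIV :: bit set)"
proof -
  have "(UNIV :: bit set) = {0, 1}" using bit_not_one_iff by auto
  then show ?thesis by (metis finite.emptyI finite.insertI)
qed

lemma finite_carrier_vec_bit: "finite (carrier_vec n :: bit vec set)"
proof -
  have fin: "finite ({..<n} \<rightarrow>\<^sub>E (UNIV :: bit set))"
    by (intro finite_PiE) (simp_all add: finite_UNIV_bit)
  have "(carrier_vec n :: bit vec set) \<subseteq> vec n ` ({..<n} \<rightarrow>\<^sub>E UNIV)"
  proof
    fix v :: "bit vec"
    assume "v \<in> carrier_vec n"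
    then have "v = vec n (restrict (($) v) {..<n})" by auto
    moreover have "restrict (($) v) {..<n} \<in> {..<n} \<rightarrow>\<^sub>E UNIV" by simp
    ultimately show "v \<in> vec n ` ({..<n} \<rightarrow>\<^sub>E UNIV)" by (rule image_eqI)
  qed
  then show ?thesis by (rule finite_surj[OF fin])
qed

lemma finite_carrier_mat_bit: "finite (carrier_mat n m :: bit mat set)"
proof -
  let ?I = "{..<n} \<times> {..<m}"
  have fin: "finite (?I \<rightarrow>\<^sub>E (UNIV :: bit set))"
    by (intro finite_PiE) (simp_all add: finite_UNIV_bit)
  have "(carrier_mat n m :: bit mat set) \<subseteq> mat n m ` (?I \<rightarrow>\<^sub>E UNIV)"
  proof
    fix W :: "bit mat"
    assume "W \<in> carrier_mat n m"
    then have "W = mat n m (restrict (($$) W) ?I)" by auto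
    moreover have "restrict (($$) W) ?I \<in> ?I \<rightarrow>\<^sub>E UNIV" by simp
    ultimately show "W \<in> mat n m ` (?I \<rightarrow>\<^sub>E UNIV)" by (rule image_eqI)
  qed
  then show ?thesis by (rule finite_surj[OF fin])
qed

lemma max_weight_set:
  "finite {weight (W *\<^sub>v x) | x. x \<in> carrier_vec (dim_col W)}"
  "{weight (W *\<^sub>v x) | x. x \<in> carrier_vec (dim_col W)} \<noteq> {}"
proof -
  show "finite {weight (W *\<^sub>v x) | x. x \<in> carrier_vec (dim_col W)}"
    using finite_carrier_vec_bit by simp
  have "weight (W *\<^sub>v 0\<^sub>v (dim_col W)) \<in> {weight (W *\<^sub>v x) | x. x \<in> carrier_vec (dim_col W)}"
    using zero_carrier_vec[of "dim_col W"] by (intro CollectI exI[of _ "0\<^sub>v (dim_col W)"] conjI refl)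
  then show "{weight (W *\<^sub>v x) | x. x \<in> carrier_vec (dim_col W)} \<noteq> {}" by blast
qed

lemma mu_set:
  "finite {max_weight W | W. W \<in> A_mats n m}"
  "m \<ge> 1 \<Longrightarrow> {max_weight W | W. W \<in> A_mats n m} \<noteq> {}"
proof -
  have "finite (A_mats n m)"
    by (rule finite_subset[OF _ finite_carrier_mat_bit[of n n]]) (auto simp: A_mats_def)
  then show "finite {max_weight W | W. W \<in> A_mats n m}" by simp
next
  assume "m \<ge> 1"
  have "weight (col (1\<^sub>m n) j) \<le> m" if "j < n" for j
  proof -
    have "{i. i < n \<and> col (1\<^sub>m n :: bit mat) j $ i = 1} = {j}"
      using that by (auto split: if_splits)
    then have "weight (col (1\<^sub>m n) j) = 1" by (simp add: weight_def)
    then show ?thesis using \<open>m \<ge> 1\<close> by simp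
  qed
  then have "1\<^sub>m n \<in> A_mats n m" by (simp add: A_mats_def)
  then show "{max_weight W | W. W \<in> A_mats n m} \<noteq> {}" by blast
qed

lemma pow_block_unique:
  fixes x j j' :: nat
  assumes "2 ^ j \<le> x" "x < 2 ^ (j + 1)" "2 ^ j' \<le> x" "x < 2 ^ (j' + 1)"
  shows "j = j'"
proof -
  have "(2::nat) ^ j < 2 ^ (j' + 1)" "(2::nat) ^ j' < 2 ^ (j + 1)"
    using assms by linarith+
  then have "j < j' + 1" "j' < j + 1"
    by (simp_all only: power_strict_increasing_iff one_less_numeral_iff num.simps semiring_norm)
  then show ?thesis by simp
qed

lemma pow_block_inner:
  fixes i j :: nat
  assumes "1 \<le> i" "i \<le> 2 ^ j - 1"
  shows "2 ^ j \<le> 2 ^ j - 1 + i" "2 ^ j - 1 + i < 2 ^ (j + 1)" "2 ^ j - 1 + i < 2 ^ (j + 1) - 1"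
proof -
  obtain c :: nat where c: "2 ^ j = Suc c" using not0_implies_Suc[of "2 ^ j"] by auto
  show "2 ^ j \<le> 2 ^ j - 1 + i" "2 ^ j - 1 + i < 2 ^ (j + 1)" "2 ^ j - 1 + i < 2 ^ (j + 1) - 1"
    using assms by (simp_all add: c)
qed

lemma pow_block_end:
  fixes j :: nat
  shows "(2::nat) ^ j \<le> 2 ^ (j + 1) - 1" "(2::nat) ^ (j + 1) - 1 < 2 ^ (j + 1)"
proof -
  obtain c :: nat where c: "2 ^ j = Suc c" using not0_implies_Suc[of "2 ^ j"] by auto
  show "(2::nat) ^ j \<le> 2 ^ (j + 1) - 1" "(2::nat) ^ (j + 1) - 1 < 2 ^ (j + 1)"
    by (simp_all add: c)
qed

text \<open>The sequence starts at index 1; the value at 0 is irrelevant.\<close>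

function a_seq :: "nat \<Rightarrow> nat"
  where
    "a_seq 0 = 0"
  | "a_seq 1 = 1"
  | "j \<ge> 1 \<Longrightarrow> 1 \<le> i \<Longrightarrow> i \<le> 2 ^ j - 1 \<Longrightarrow> a_seq (2 ^ j - 1 + i) = 2 ^ (j - 1) + a_seq i"
  | "j \<ge> 1 \<Longrightarrow> a_seq (2 ^ (j + 1) - 1) = 2 ^ j"
proof goal_cases
  case (1 P x)
  show P
  proof (cases "x < 2")
    case True
    then have "x = 0 \<or> x = 1" by auto
    then show P using 1(1,2) by blast
  next
    case False
    define j where "j = floor_log x"
    have lo: "2 ^ j \<le> x" and hi: "x < 2 ^ (j + 1)"
      using False floor_log_exp2_le[of x] floor_log_exp2_gt[of x] by (auto simp: j_def)
    have j: "j \<ge> 1" using False floor_log_rec[of x] unfolding j_def by linarith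
    show P
    proof (cases "x = 2 ^ (j + 1) - 1")
      case True
      then show P using 1(4) j by blast
    next
      case False
      define i where "i = x - (2 ^ j - 1)"
      have "(1::nat) \<le> 2 ^ j" by simp
      then have "x = 2 ^ j - 1 + i" "1 \<le> i" using lo by (auto simp: i_def)
      moreover have "i \<le> 2 ^ j - 1" using lo hi False by (auto simp: i_def)
      ultimately show P using 1(3) j by blast
    qed
  qed
next
  case (9 j i j' i')
  then have "j = j'"
    using pow_block_inner[of j i] pow_block_inner[of j' i']
    by (intro pow_block_unique[of _ "2 ^ j - 1 + i"]) simp_all
  with 9(7) have "i = i'" by (simp only: add_left_cancel)
  with \<open>j = j'\<close> show ?case by simp
next
  case (10 j i j')
  have "2 ^ j - 1 + i < 2 ^ (j + 1) - 1" "2 ^ j \<le> 2 ^ j - 1 + i"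
    using pow_block_inner[OF 10(2,3)] by simp_all
  moreover have "j = j'"
    using 10 pow_block_inner[of j i] pow_block_end[of j']
    by (intro pow_block_unique[of _ "2 ^ j - 1 + i"]) simp_all
  ultimately show ?case using 10(5) by simp
next
  case (11 j j')
  then have "j = j'"
    using pow_block_end[of j] pow_block_end[of j']
    by (intro pow_block_unique[of _ "2 ^ (j + 1) - 1"]) simp_all
  then show ?case by simp
next
  case (4 j i)
  then show ?case using pow_block_inner[of j i] by simp
next
  case (5 j)
  then show ?case using pow_block_end(1)[of j] by (metis le_zero_eq)
next
  case (7 j i)
  have "(2::nat) ^ 1 \<le> 2 ^ j" using 7 by (intro power_increasing) simp_all
  then show ?case using 7 pow_block_inner[of j i] by simp
next
  case (8 j)
  have "(2::nat) ^ 1 \<le> 2 ^ j" using 8 by (intro power_increasing) simp_all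
  then show ?case using 8 pow_block_end[of j] by simp
next
  case 2 show ?case by (rule refl)
next
  case 3 then show ?case by simp
next
  case 6 show ?case by (rule refl)
qed
termination
proof (relation "measure id", goal_cases)
  case (2 j i)
  then have "(2::nat) ^ 1 \<le> 2 ^ j" by (intro power_increasing) auto
  then show ?case by simp
qed simp

text \<open>For \<open>n \<ge> 1\<close> the remainder \<open>r\<close> of \<open>n\<close> modulo \<open>2 ^ (j + 1) - 1\<close> is taken in
  \<open>{1..2 ^ (j + 1) - 1}\<close>, hence the shifts by one; \<open>U_eq\<close> below is the textbook description.\<close>

definition U :: "nat \<Rightarrow> nat \<Rightarrow> nat"
  where "U n m =
    (let j = floor_log m;
         q = (n - 1) div (2 ^ (j + 1) - 1);
         r = (n - 1) mod (2 ^ (j + 1) - 1) + 1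
     in q * 2 ^ j + a_seq r)"

lemma U_eq:
  assumes "2 ^ j \<le> m" "m < 2 ^ (j + 1)"
    and "n = (2 ^ (j + 1) - 1) * q + r" "1 \<le> r" "r \<le> 2 ^ (j + 1) - 1"
  shows "U n m = q * 2 ^ j + a_seq r"
proof -
  let ?d = "2 ^ (j + 1) - 1 :: nat"
  have "0 < (2::nat) ^ j" by simp
  then have "m > 0" using assms(1) by (rule less_le_trans)
  then have j: "floor_log m = j"
    using assms(1,2) floor_log_exp2_le[of m] floor_log_exp2_gt[of m]
    by (intro pow_block_unique[of _ m]) auto
  have n1: "n - 1 = ?d * q + (r - 1)" and lt: "r - 1 < ?d" using assms(3-5) by auto
  have "(n - 1) div ?d = q" "(n - 1) mod ?d = r - 1"
    unfolding n1 using lt by simp_all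
  then show ?thesis using j assms(4) by (simp add: U_def)
qed

end

theory Submission
  imports Defs
begin

text \<open>
  Identify a vector over \<open>\<bbbF>\<^sub>2\<close> with its support. The column space of a matrix in \<open>A_mats n p\<close>
  is then a family of subsets of \<open>{..<n}\<close> that is closed under symmetric difference and in which
  every point lies in a word of size at most \<open>p\<close>; \<open>mu n p\<close> is the least possible size of the
  largest word. Direct sums of simplex codes give the upper bound. For the lower bound let \<open>w\<close> be
  a largest word and restrict the code to a set \<open>T\<close> disjoint from \<open>w\<close>. As adding \<open>w\<close> to a word
  never produces more than \<open>card w\<close> points, a word \<open>c\<close> meets \<open>T\<close> in at most \<open>card c div 2\<close>
  and in at most \<open>card w div 2\<close> points. Hence \<open>mu (card T) (p div 2) \<le> card w div 2\<close>. Let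
  \<open>2 ^ k \<le> p < 2 ^ (k + 1)\<close>, so that \<open>p div 2 \<le> 2 ^ k - 1\<close>. If \<open>card w\<close> were less than \<open>U n p\<close>,
  there would be room for a \<open>T\<close> with \<open>t = n - U n p + 1\<close> elements, contradicting
  \<open>U n p \<le> 2 * U t (2 ^ k - 1)\<close>.
\<close>

section \<open>Translation between matrices and set families\<close>

definition covering_code :: "nat \<Rightarrow> 'a set \<Rightarrow> 'a set set \<Rightarrow> bool"
  where "covering_code p S C \<longleftrightarrow> C \<subseteq> Pow S \<and> {} \<in> C \<and> (\<forall>c\<in>C. \<forall>d\<in>C. sym_diff c d \<in> C) \<and>
    (\<forall>i\<in>S. \<exists>c\<in>C. i \<in> c \<and> card c \<le> p)"

lemma of_bool_sym_diff: "(of_bool (i \<in> sym_diff c d) :: bit) = of_bool (i \<in> c) + of_bool (i \<in> d)"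
  by auto

lemma bit_mult_of_bool: "(of_bool P :: bit) * x = of_bool (P \<and> x = 1)"
  by (cases x) auto

lemma max_weight_ge:
  assumes "x \<in> carrier_vec (dim_col W)"
  shows "weight (W *\<^sub>v x) \<le> max_weight W"
  unfolding max_weight_def using assms by (intro Max_ge max_weight_set(1)) blast

lemma max_weight_le:
  assumes "\<And>x. x \<in> carrier_vec (dim_col W) \<Longrightarrow> weight (W *\<^sub>v x) \<le> b"
  shows "max_weight W \<le> b"
  unfolding max_weight_def using assms max_weight_set by (subst Max_le_iff) auto

text \<open>Taking as column of each point a small word through it gives diagonal entries 1 and
  light columns, and every product \<open>W *\<^sub>v x\<close> is a sum of words, hence a word. The
  type of \<open>S\<close> is left free so that disjoint sums and power sets can serve as coordinate
  sets.\<close>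

lemma mu_le:
  assumes "finite S" "covering_code p S C" "\<And>c. c \<in> C \<Longrightarrow> card c \<le> b"
  shows "mu (card S) p \<le> b"
proof -
  let ?n = "card S"
  obtain h where h: "bij_betw h {..<?n} S"
    using ex_bij_betw_nat_finite[OF assms(1)] by (auto simp: atLeast0LessThan)
  have hS: "h i \<in> S" if "i < ?n" for i using h that by (auto simp: bij_betw_def)
  have CS: "c \<subseteq> S" if "c \<in> C" for c using assms(2) that by (auto simp: covering_code_def)
  have card_h: "card {i. i < ?n \<and> h i \<in> c} = card c" if "c \<in> C" for c
  proof -
    have "h ` {i. i < ?n \<and> h i \<in> c} = c"
      using h CS[OF that] by (fastforce simp: bij_betw_def)
    moreover have "inj_on h {i. i < ?n \<and> h i \<in> c}"
      using h by (auto simp: bij_betw_def inj_on_def)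
    ultimately show ?thesis by (metis card_image)
  qed
  obtain g where g: "\<And>i. i \<in> S \<Longrightarrow> g i \<in> C \<and> i \<in> g i \<and> card (g i) \<le> p"
    using assms(2) unfolding covering_code_def by metis
  define W :: "bit mat" where "W = mat ?n ?n (\<lambda>(i, j). of_bool (h i \<in> g (h j)))"
  have "weight (col W j) \<le> p" if "j < ?n" for j
  proof -
    have "{i. i < ?n \<and> col W j $ i = 1} = {i. i < ?n \<and> h i \<in> g (h j)}"
      using that by (auto simp: W_def)
    then have "weight (col W j) = card {i. i < ?n \<and> h i \<in> g (h j)}"
      using that by (simp add: weight_def W_def)
    then show ?thesis using card_h g hS that by simp
  qed
  then have WA: "W \<in> A_mats ?n p"
    using g hS by (simp add: A_mats_def W_def)
  have "max_weight W \<le> b"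
  proof (rule max_weight_le)
    fix x :: "bit vec" assume x: "x \<in> carrier_vec (dim_col W)"
    \<comment> \<open>Adding one column at a time keeps the partial sum the indicator of a word, by
      closure under symmetric difference.\<close>
    have "\<exists>c\<in>C. \<forall>i<?n. (\<Sum>j\<in>J. of_bool (h i \<in> g (h j)) * x $ j) = of_bool (h i \<in> c)"
      if "finite J" "J \<subseteq> {..<?n}" for J
      using that
    proof (induction J rule: finite_induct)
      case empty
      then show ?case using assms(2) by (intro bexI[of _ "{}"]) (auto simp: covering_code_def)
    next
      case (insert j J)
      then obtain c where c: "c \<in> C"
        "\<forall>i<?n. (\<Sum>j\<in>J. of_bool (h i \<in> g (h j)) * x $ j) = of_bool (h i \<in> c)" by auto
      define d where "d = (if x $ j = 1 then g (h j) else {})"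
      have "g (h j) \<in> C" using g hS insert.prems by auto
      then have "d \<in> C" using assms(2) by (auto simp: covering_code_def d_def)
      then have "sym_diff d c \<in> C" using c(1) assms(2) by (auto simp: covering_code_def)
      moreover have "(\<Sum>j\<in>insert j J. of_bool (h i \<in> g (h j)) * x $ j) = of_bool (h i \<in> sym_diff d c)"
        if "i < ?n" for i
      proof -
        have "(\<Sum>j\<in>insert j J. of_bool (h i \<in> g (h j)) * x $ j)
            = of_bool (h i \<in> g (h j)) * x $ j + of_bool (h i \<in> c)"
          using insert.hyps by (subst sum.insert) (simp_all only: c(2)[rule_format, OF that] not_False_eq_True)
        also have "of_bool (h i \<in> g (h j)) * x $ j = of_bool (h i \<in> d)"
          unfolding bit_mult_of_bool by (simp add: d_def)
        finally show ?thesis by (simp only: of_bool_sym_diff)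
      qed
      ultimately show ?case by blast
    qed
    from this[of "{..<?n}"] obtain c where c: "c \<in> C"
      "\<forall>i<?n. (\<Sum>j<?n. of_bool (h i \<in> g (h j)) * x $ j) = of_bool (h i \<in> c)" by auto
    have "(W *\<^sub>v x) $ i = of_bool (h i \<in> c)" if "i < ?n" for i
      using c(2) x that by (simp add: W_def scalar_prod_def atLeast0LessThan)
    then have "{i. i < ?n \<and> (W *\<^sub>v x) $ i = 1} = {i. i < ?n \<and> h i \<in> c}" by auto
    then have "weight (W *\<^sub>v x) = card c"
      using card_h[OF c(1)] by (simp add: weight_def W_def)
    then show "weight (W *\<^sub>v x) \<le> b" using assms(3) c(1) by simp
  qed
  moreover have "mu ?n p \<le> max_weight W"
    unfolding mu_def using WA by (intro Min_le mu_set) blast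
  ultimately show ?thesis by simp
qed

text \<open>Converse passage: the column space of a minimising matrix, which exists because
  \<open>p \<ge> 1\<close> makes \<open>A_mats n p\<close> nonempty. The small word through
  \<open>i\<close> is column \<open>i\<close>, the image of a unit vector; it contains
  \<open>i\<close> because of the diagonal.\<close>

lemma mu_attained:
  assumes "p \<ge> 1"
  obtains C where "covering_code p {..<n} C" "\<And>c. c \<in> C \<Longrightarrow> card c \<le> mu n p"
proof -
  have "mu n p \<in> {max_weight W | W. W \<in> A_mats n p}"
    unfolding mu_def using mu_set assms by (intro Min_in) auto
  then obtain W where W: "W \<in> A_mats n p" and mw: "mu n p = max_weight W" by auto
  have Wc: "W \<in> carrier_mat n n" using W by (simp add: A_mats_def)
  define s where "s u = {i. i < n \<and> u $ i = (1::bit)}" for u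
  have s_weight: "card (s u) = weight u" if "u \<in> carrier_vec n" for u
    using that by (simp add: s_def weight_def)
  define C where "C = (\<lambda>x. s (W *\<^sub>v x)) ` carrier_vec n"
  have add: "sym_diff (s (W *\<^sub>v x)) (s (W *\<^sub>v y)) = s (W *\<^sub>v (x + y))"
    if "x \<in> carrier_vec n" "y \<in> carrier_vec n" for x y
  proof -
    have "(W *\<^sub>v (x + y)) $ i = (W *\<^sub>v x) $ i + (W *\<^sub>v y) $ i" if "i < n" for i
      using mult_add_distrib_mat_vec[OF Wc \<open>x \<in> _\<close> \<open>y \<in> _\<close>] Wc that by simp
    moreover have "a + b = 1 \<longleftrightarrow> (a = 1) \<noteq> (b = 1)" for a b :: bit
      by (cases a; cases b) auto
    ultimately show ?thesis by (auto simp: s_def)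
  qed
  have "covering_code p {..<n} C"
    unfolding covering_code_def
  proof (intro conjI ballI)
    show "C \<subseteq> Pow {..<n}" by (auto simp: C_def s_def)
    have "s (W *\<^sub>v 0\<^sub>v n) = {}" using Wc by (auto simp: s_def)
    then show "{} \<in> C" unfolding C_def by (metis image_eqI zero_carrier_vec)
  next
    fix c d assume "c \<in> C" "d \<in> C"
    then show "sym_diff c d \<in> C" using add by (auto simp: C_def)
  next
    fix i assume i: "i \<in> {..<n}"
    have col: "W *\<^sub>v unit_vec n i = col W i"
      using i Wc by (intro eq_vecI) auto
    have "s (col W i) \<in> C"
      unfolding C_def by (intro image_eqI[of _ _ "unit_vec n i"]) (simp_all add: col)
    moreover have "i \<in> s (col W i)" using W i by (auto simp: s_def A_mats_def)
    moreover have "card (s (col W i)) \<le> p"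
      using W Wc i by (simp add: s_weight A_mats_def)
    ultimately show "\<exists>c\<in>C. i \<in> c \<and> card c \<le> p" by blast
  qed
  moreover have "card c \<le> mu n p" if "c \<in> C" for c
    using that max_weight_ge[of _ W] Wc by (auto simp: C_def s_weight mw)
  ultimately show ?thesis using that by blast
qed

subsection \<open>Upper bound\<close>

text \<open>Direct sum of two optimal codes. Small words are padded with the empty word of the other
  summand, so the covering bound \<open>p\<close> survives.\<close>

lemma mu_add:
  assumes "p \<ge> 1"
  shows "mu (n + n') p \<le> mu n p + mu n' p"
proof -
  obtain C where C: "covering_code p {..<n} C" "\<And>c. c \<in> C \<Longrightarrow> card c \<le> mu n p"
    using mu_attained assms by blast
  obtain C' where C': "covering_code p {..<n'} C'" "\<And>c. c \<in> C' \<Longrightarrow> card c \<le> mu n' p"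
    using mu_attained assms by blast
  define D where "D = {c <+> d | c d. c \<in> C \<and> d \<in> C'}"
  have fin: "finite c" if "c \<in> C \<or> c \<in> C'" for c
    using that C(1) C'(1) unfolding covering_code_def by (meson PowD finite_lessThan finite_subset subsetD)
  have "covering_code p ({..<n} <+> {..<n'}) D"
    unfolding covering_code_def
  proof (intro conjI ballI)
    show "D \<subseteq> Pow ({..<n} <+> {..<n'})"
      unfolding D_def using C(1) C'(1) by (auto simp: covering_code_def Plus_def; blast)
    have "{} <+> {} \<in> D" using C(1) C'(1) by (auto simp: D_def covering_code_def)
    then show "{} \<in> D" by (simp add: Plus_def)
  next
    fix c d assume "c \<in> D" "d \<in> D"
    then obtain c1 c2 d1 d2 where "c = c1 <+> c2" "d = d1 <+> d2"
      and in_C: "c1 \<in> C" "d1 \<in> C" "c2 \<in> C'" "d2 \<in> C'"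
      by (auto simp: D_def)
    then have "sym_diff c d = sym_diff c1 d1 <+> sym_diff c2 d2" by auto
    moreover have "sym_diff c1 d1 \<in> C" "sym_diff c2 d2 \<in> C'"
      using in_C C(1) C'(1) by (simp_all add: covering_code_def)
    ultimately show "sym_diff c d \<in> D" unfolding D_def by blast
  next
    fix i assume "i \<in> {..<n} <+> {..<n'}"
    then show "\<exists>c\<in>D. i \<in> c \<and> card c \<le> p"
    proof (elim PlusE)
      fix j assume j: "j \<in> {..<n}" "i = Inl j"
      then obtain c where c: "c \<in> C" "j \<in> c" "card c \<le> p" using C(1) unfolding covering_code_def by blast
      then have "c <+> {} \<in> D" using C'(1) by (auto simp: D_def covering_code_def)
      then show ?thesis using c j fin by (intro bexI[of _ "c <+> {}"]) (auto simp: card_Plus)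
    next
      fix j assume j: "j \<in> {..<n'}" "i = Inr j"
      then obtain c where c: "c \<in> C'" "j \<in> c" "card c \<le> p" using C'(1) unfolding covering_code_def by blast
      then have "{} <+> c \<in> D" using C(1) by (auto simp: D_def covering_code_def)
      then show ?thesis using c j fin by (intro bexI[of _ "{} <+> c"]) (auto simp: card_Plus)
    qed
  qed
  moreover have "card c \<le> mu n p + mu n' p" if "c \<in> D" for c
    using that C(2) C'(2) fin by (auto simp: D_def card_Plus add_mono)
  ultimately have "mu (card ({..<n} <+> {..<n'})) p \<le> mu n p + mu n' p"
    by (intro mu_le) auto
  then show ?thesis by (simp add: card_Plus)
qed

lemma mu_mult_add:
  assumes "p \<ge> 1"
  shows "mu (q * n + r) p \<le> q * mu n p + mu r p"
proof (induction q)
  case (Suc q)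
  have "mu (Suc q * n + r) p \<le> mu n p + mu (q * n + r) p"
    using mu_add[OF assms, of n "q * n + r"] by (simp add: ac_simps)
  then show ?case using Suc by simp
qed simp

section \<open>Simplex codes, with the parity of an intersection as inner product\<close>

lemma even_card_Int_sym_diff:
  assumes "finite X"
  shows "even (card (X \<inter> sym_diff Y Z)) \<longleftrightarrow> (even (card (X \<inter> Y)) \<longleftrightarrow> even (card (X \<inter> Z)))"
proof -
  have "card (X \<inter> Y) = card (X \<inter> (Y - Z)) + card (X \<inter> (Y \<inter> Z))"
    using assms by (subst card_Un_disjoint[symmetric]) (auto intro: arg_cong[of _ _ card])
  moreover have "card (X \<inter> Z) = card (X \<inter> (Z - Y)) + card (X \<inter> (Y \<inter> Z))"
    using assms by (subst card_Un_disjoint[symmetric]) (auto intro: arg_cong[of _ _ card])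
  moreover have "card (X \<inter> sym_diff Y Z) = card (X \<inter> (Y - Z)) + card (X \<inter> (Z - Y))"
    using assms by (subst card_Un_disjoint[symmetric]) (auto intro: arg_cong[of _ _ card])
  ultimately show ?thesis by auto
qed

text \<open>Toggling a fixed \<open>y \<in> Y\<close> in \<open>X\<close> flips the parity, so the
  odd and the even sets are equinumerous.\<close>

lemma card_odd_Int:
  assumes "finite A" "Y \<subseteq> A" "Y \<noteq> {}"
  shows "2 * card {X \<in> Pow A. odd (card (X \<inter> Y))} = 2 ^ card A"
proof -
  obtain y where y: "y \<in> Y" using assms by auto
  let ?O = "{X \<in> Pow A. odd (card (X \<inter> Y))}" and ?E = "{X \<in> Pow A. even (card (X \<inter> Y))}"
  have flip: "even (card (sym_diff X {y} \<inter> Y)) \<longleftrightarrow> odd (card (X \<inter> Y))" for X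
    using even_card_Int_sym_diff[of Y X "{y}"] assms y finite_subset[OF assms(2,1)]
    by (simp add: Int_commute)
  have "bij_betw (\<lambda>X. sym_diff X {y}) ?O ?E"
    by (rule bij_betw_byWitness[where f' = "\<lambda>X. sym_diff X {y}"])
      (use flip y assms(2) in \<open>auto split: if_splits\<close>)
  then have "card ?O = card ?E" by (rule bij_betw_same_card)
  moreover have "card ?O + card ?E = card (Pow A)"
    using assms(1) by (subst card_Un_disjoint[symmetric]) (auto intro: arg_cong[of _ _ card])
  ultimately show ?thesis using assms(1) by (simp add: card_Pow)
qed

text \<open>The words are those of the simplex code: its coordinates are the nonzero vectors \<open>X\<close> of
  \<open>\<bbbF>\<^sub>2\<^bsup>j+1\<^esup>\<close>, and each linear functional \<open>X \<mapsto> \<langle>X, Y\<rangle>\<close> gives a word.\<close>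

lemma mu_simplex:
  assumes "2 ^ j \<le> p"
  shows "mu (2 ^ (j + 1) - 1) p \<le> 2 ^ j"
proof -
  define S where "S = Pow {..j} - {{}}"
  define w where "w Y = {X \<in> Pow {..j}. odd (card (X \<inter> Y))}" for Y
  have card_w: "card (w Y) \<le> 2 ^ j" if "Y \<subseteq> {..j}" for Y
    using card_odd_Int[of "{..j}" Y] that by (cases "Y = {}") (auto simp: w_def)
  have "covering_code p S (w ` Pow {..j})"
    unfolding covering_code_def
  proof (intro conjI ballI)
    show "w ` Pow {..j} \<subseteq> Pow S" by (auto simp: w_def S_def)
    have "w {} = {}" by (simp add: w_def)
    then show "{} \<in> w ` Pow {..j}" by (metis Pow_bottom imageI)
  next
    fix c d assume "c \<in> w ` Pow {..j}" "d \<in> w ` Pow {..j}"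
    then obtain Y Z where YZ: "c = w Y" "Y \<subseteq> {..j}" "d = w Z" "Z \<subseteq> {..j}" by auto
    have "w (sym_diff Y Z) = sym_diff c d"
      using even_card_Int_sym_diff[of _ Y Z] finite_subset[of _ "{..j}"] YZ
      unfolding w_def by auto
    then show "sym_diff c d \<in> w ` Pow {..j}"
      using YZ by (intro image_eqI[of _ _ "sym_diff Y Z"]) auto
  next
    fix X assume "X \<in> S"
    then obtain x where x: "x \<in> X" "X \<subseteq> {..j}" by (auto simp: S_def)
    \<comment> \<open>A coordinate functional that is nonzero at \<open>X\<close> covers the point
      \<open>X\<close>.\<close>
    then have "X \<inter> {x} = {x}" by auto
    then have "X \<in> w {x}" using x by (simp add: w_def)
    then show "\<exists>c\<in>w ` Pow {..j}. X \<in> c \<and> card c \<le> p"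
      using x card_w[of "{x}"] assms by (intro bexI[of _ "w {x}"]) auto
  qed
  moreover have "card S = 2 ^ (j + 1) - 1" by (simp add: S_def card_Pow card_Diff_subset)
  ultimately show ?thesis
    using card_w mu_le[of S p "w ` Pow {..j}" "2 ^ j"] by (auto simp: S_def)
qed

text \<open>The recursion of \<open>a_seq\<close> splits off the longest simplex code that fits, of
  length \<open>2 ^ l - 1\<close> and maximal weight \<open>2 ^ (l - 1)\<close>. The bound on
  \<open>r\<close> keeps all these weights at most \<open>2 ^ j \<le> p\<close>.\<close>

lemma mu_le_a_seq:
  assumes "2 ^ j \<le> p" "1 \<le> r" "r \<le> 2 ^ (j + 1) - 1"
  shows "mu r p \<le> a_seq r"
  using assms(2,3)
proof (induction r rule: a_seq.induct)
  case 2
  have "2 ^ 0 \<le> p" using assms(1) by (metis le_trans one_le_numeral one_le_power power_0)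
  then show ?case using mu_simplex[of 0 p] a_seq.simps(2) by simp
next
  case (3 l i)
  have "2 ^ l < (2::nat) ^ (j + 1)"
    using le_trans[OF pow_block_inner(1)[OF 3(2,3)] 3(6)] pow_block_end(2)[of j] by (rule le_less_trans)
  then have "l < j + 1" by (rule power_less_imp_less_exp[rotated]) simp
  then have "2 ^ (l - 1) \<le> (2::nat) ^ j" by (intro power_increasing) auto
  then have "2 ^ (l - 1) \<le> p" using assms(1) by (rule le_trans)
  then have "mu (2 ^ l - 1) p \<le> 2 ^ (l - 1)"
    using mu_simplex[of "l - 1" p] 3(1) by simp
  moreover have "mu i p \<le> a_seq i" using 3 by simp
  moreover have "p \<ge> 1" using assms(1) by (metis le_trans one_le_numeral one_le_power)
  ultimately show ?case using mu_add[of p "2 ^ l - 1" i] 3(1-3) a_seq.simps(3)[of l i] by linarith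
next
  case (4 l)
  have "2 ^ (l + 1) \<le> (2::nat) ^ (j + 1)" using le_less_trans[OF 4(3) pow_block_end(2)] by linarith
  then have "2 ^ l \<le> (2::nat) ^ j" by simp
  then have "2 ^ l \<le> p" using assms(1) by (rule le_trans)
  then show ?case using mu_simplex[of l p] a_seq.simps(4)[OF 4(1)] by simp
qed simp

text \<open>Direct sum of \<open>q\<close> simplex codes of length \<open>N\<close> and a code for
  the remainder.\<close>

lemma mu_le_U:
  assumes "n \<ge> 1" "p \<ge> 1"
  shows "mu n p \<le> U n p"
proof -
  define j where "j = floor_log p"
  have j: "2 ^ j \<le> p" "p < 2 ^ (j + 1)"
    using assms(2) floor_log_exp2_le[of p] floor_log_exp2_gt[of p] by (auto simp: j_def)
  define N :: nat where "N = 2 ^ (j + 1) - 1"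
  define q r where "q = (n - 1) div N" and "r = (n - 1) mod N + 1"
  have "(1::nat) \<le> 2 ^ j" by simp
  then have "1 \<le> N" unfolding N_def using pow_block_end(1) by (rule le_trans)
  then have r: "1 \<le> r" "r \<le> N" by (simp_all add: r_def Suc_le_eq)
  have n: "n = N * q + r" using assms(1) by (simp add: q_def r_def)
  have "mu n p \<le> q * mu N p + mu r p" using mu_mult_add[OF assms(2), of q N r] n by (simp add: mult.commute)
  also have "\<dots> \<le> q * 2 ^ j + a_seq r"
    using mu_simplex[OF j(1)] mu_le_a_seq[OF j(1)] r by (intro add_mono mult_left_mono) (simp_all add: N_def)
  also have "\<dots> = U n p" using U_eq[OF j] n r by (simp add: N_def)
  finally show ?thesis .
qed

subsection \<open>Lower bound\<close>

text \<open>A form of the residual code construction: restricting to points off a heaviest word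
  halves both the covering bound and the maximal weight.\<close>

lemma mu_disjoint_max_word:
  assumes "finite S" "covering_code p S C"
    and w: "w \<in> C" "\<And>c. c \<in> C \<Longrightarrow> card c \<le> card w"
    and T: "T \<subseteq> S - w" and "p div 2 \<le> q"
  shows "mu (card T) q \<le> card w div 2"
proof (rule mu_le)
  show "finite T" using T assms(1) finite_subset by blast
  have fin: "finite c" if "c \<in> C" for c
    using that assms(1,2) unfolding covering_code_def by (meson PowD finite_subset subsetD)
  have bounds: "2 * card (c \<inter> T) \<le> card c" "2 * card (c \<inter> T) \<le> card w" if c: "c \<in> C" for c
  proof -
    have "card (c \<inter> T) \<le> card (c - w)" using T fin[OF c] by (intro card_mono) auto
    moreover have "card c = card (c - w) + card (c \<inter> w)"
      using fin[OF c] by (subst card_Un_disjoint[symmetric]) (auto intro: arg_cong[of _ _ card])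
    moreover have "card w = card (w - c) + card (c \<inter> w)"
      using fin[OF w(1)] by (subst card_Un_disjoint[symmetric]) (auto intro: arg_cong[of _ _ card])
    moreover have "card (sym_diff c w) = card (c - w) + card (w - c)"
      using fin c w(1) by (subst card_Un_disjoint[symmetric]) auto
    \<comment> \<open>Maximality of \<open>w\<close>, applied to the sum of \<open>c\<close> and
      \<open>w\<close>, yields \<open>card (c - w) \<le> card (c \<inter> w)\<close>; both bounds
      follow from this.\<close>
    moreover have "card (sym_diff c w) \<le> card w"
      using assms(2) c w unfolding covering_code_def by blast
    ultimately show "2 * card (c \<inter> T) \<le> card c" "2 * card (c \<inter> T) \<le> card w"
      using w(2)[OF c] by linarith+
  qed
  show "covering_code q T ((\<lambda>c. c \<inter> T) ` C)"
    unfolding covering_code_def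
  proof (intro conjI ballI)
    show "{} \<in> (\<lambda>c. c \<inter> T) ` C" using assms(2) by (force simp: covering_code_def)
  next
    fix c d assume "c \<in> (\<lambda>c. c \<inter> T) ` C" "d \<in> (\<lambda>c. c \<inter> T) ` C"
    then obtain c' d' where "c = c' \<inter> T" "c' \<in> C" "d = d' \<inter> T" "d' \<in> C" by auto
    moreover from this have "sym_diff c d = sym_diff c' d' \<inter> T" by auto
    ultimately show "sym_diff c d \<in> (\<lambda>c. c \<inter> T) ` C"
      using assms(2) unfolding covering_code_def by blast
  next
    fix i assume i: "i \<in> T"
    then obtain c where c: "c \<in> C" "i \<in> c" "card c \<le> p"
      using assms(2) T unfolding covering_code_def by blast
    then have "card (c \<inter> T) \<le> q" using bounds(1)[OF c(1)] \<open>p div 2 \<le> q\<close> by linarith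
    then show "\<exists>c\<in>(\<lambda>c. c \<inter> T) ` C. i \<in> c \<and> card c \<le> q" using c i by blast
  qed auto
  fix c assume "c \<in> (\<lambda>c. c \<inter> T) ` C"
  then show "card c \<le> card w div 2" using bounds(2) by fastforce
qed

section \<open>Arithmetic of \<open>a_seq\<close> and \<open>U\<close>\<close>

lemma a_seq_pow: "a_seq (2 ^ (j + 1) - 1) = 2 ^ j"
  using a_seq.simps(2) a_seq.simps(4)[of j] by (cases "j = 0") auto

lemma a_seq_le: "a_seq r \<le> r"
proof (induction r rule: a_seq.induct)
  case (3 j i)
  have "(2::nat) ^ (j - 1) \<le> 2 ^ j - 1" using 3(1) by (cases j) (simp_all add: Suc_le_eq)
  then show ?case using 3 a_seq.simps(3)[of j i] by linarith
next
  case (4 j)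
  then show ?case using a_seq.simps(4)[of j] pow_block_end(1)[of j] by simp
qed (simp_all only: a_seq.simps(1,2) order_refl)

text \<open>This keeps the index \<open>r - a_seq r + 1\<close> within a block of length
  \<open>2 ^ i - 1\<close>. At \<open>r = 2 ^ (i + 1) - 1\<close> it would fail by exactly one, so
  that endpoint is treated separately wherever the lemma is applied.\<close>

lemma a_seq_ge:
  assumes "1 \<le> r" "r < 2 ^ (i + 1) - 1"
  shows "r + 2 \<le> a_seq r + 2 ^ i"
  using assms
proof (induction r arbitrary: i rule: a_seq.induct)
  case 2
  then have "i \<ge> 1" by (cases i) auto
  then have "(2::nat) ^ 1 \<le> 2 ^ i" by (intro power_increasing) auto
  then show ?case using a_seq.simps(2) by simp
next
  case (3 l r)
  have a: "a_seq (2 ^ l - 1 + r) = 2 ^ (l - 1) + a_seq r" using 3(1-3) by (rule a_seq.simps(3))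
  have "2 ^ l < (2::nat) ^ (i + 1)"
    using 3(2,3,6) pow_block_inner(1)[of r l] by linarith
  then have "l < i + 1" by (rule power_less_imp_less_exp[rotated]) simp
  then have "(2::nat) ^ l \<le> 2 ^ i" by (intro power_increasing) auto
  moreover have pl: "2 ^ l = 2 * (2::nat) ^ (l - 1)" using 3(1) by (cases l) auto
  \<comment> \<open>Weaker by one than the induction hypothesis, so that it also holds, with
    equality, at the endpoint \<open>r = 2 ^ l - 1\<close>.\<close>
  moreover have "r + 1 \<le> a_seq r + 2 ^ (l - 1)"
  proof (cases "r = 2 ^ l - 1")
    case True
    then show ?thesis using a_seq_pow[of "l - 1"] 3(1) pl by simp
  next
    case False
    then show ?thesis using 3(4)[of "l - 1"] 3(1-3) by simp
  qed
  ultimately show ?case using a by simp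
next
  case (4 l)
  have "2 ^ (l + 1) < (2::nat) ^ (i + 1)" using 4(3) by linarith
  then have "l + 1 < i + 1" by (rule power_less_imp_less_exp[rotated]) simp
  then have "2 ^ (l + 1) \<le> (2::nat) ^ i" by (intro power_increasing) auto
  moreover have "(1::nat) \<le> 2 ^ l" "2 ^ (l + 1) = 2 * (2::nat) ^ l" by simp_all
  ultimately show ?case unfolding a_seq.simps(4)[OF 4(1)] by linarith
qed simp

text \<open>Removing a block of length \<open>2 ^ j - 1\<close> from \<open>r\<close> removes one of
  length \<open>2 ^ (j - 1) - 1\<close> from \<open>r - a_seq r + 1\<close>, and the first block has
  twice the value of the second. Hence the inequality passes through the recursion.\<close>

lemma a_seq_le_double: "1 \<le> r \<Longrightarrow> a_seq r \<le> 2 * a_seq (r - a_seq r + 1)"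
proof (induction r rule: a_seq.induct)
  case 2
  then show ?case using a_seq.simps(2) by simp
next
  case (3 j i)
  have a: "a_seq (2 ^ j - 1 + i) = 2 ^ (j - 1) + a_seq i" using 3(1-3) by (rule a_seq.simps(3))
  have pj: "2 ^ j = 2 * (2::nat) ^ (j - 1)" using 3(1) by (cases j) auto
  have shift: "2 ^ j - 1 + i - (2 ^ (j - 1) + a_seq i) + 1 = 2 ^ (j - 1) - 1 + (i - a_seq i + 1)"
    using a_seq_le[of i] pj by simp
  show ?case
  proof (cases "i = 2 ^ j - 1")
    case True
    then have ai: "a_seq i = 2 ^ (j - 1)" using a_seq_pow[of "j - 1"] 3(1) by simp
    then have sum: "2 ^ (j - 1) - 1 + (i - a_seq i + 1) = 2 ^ (j - 1 + 1) - 1"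
      using True pj by (simp add: mult_2)
    show ?thesis unfolding a shift sum a_seq_pow by (simp add: ai)
  next
    case False
    then have "i < 2 ^ (j - 1 + 1) - 1" using 3(1,3) by simp
    then have "i + 2 \<le> a_seq i + 2 ^ (j - 1)" using a_seq_ge 3(2) by blast
    \<comment> \<open>For \<open>j = 1\<close> the preceding inequality would contradict
      \<open>a_seq i \<le> i\<close>.\<close>
    moreover from this have "j \<ge> 2" using 3(1) a_seq_le[of i] by (cases "j = 1") auto
    ultimately have "a_seq (2 ^ (j - 1) - 1 + (i - a_seq i + 1)) = 2 ^ (j - 1 - 1) + a_seq (i - a_seq i + 1)"
      using a_seq_le[of i] by (intro a_seq.simps(3)) auto
    moreover have "2 ^ (j - 1) = 2 * (2::nat) ^ (j - 1 - 1)" using \<open>j \<ge> 2\<close> by (cases "j - 1") auto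
    ultimately show ?thesis unfolding a shift using 3(4)[OF 3(2)] by simp
  qed
next
  case (4 j)
  \<comment> \<open>Here the index on the right is \<open>2 ^ j\<close>, one past a full
    block.\<close>
  have "a_seq (2 ^ j - 1 + 1) = 2 ^ (j - 1) + a_seq 1"
    using 4(1) le_trans[OF one_le_power pow_block_end(1)[of "j - 1"]] by (intro a_seq.simps(3)) simp_all
  moreover have "2 ^ (j + 1) - 1 - (2::nat) ^ j + 1 = 2 ^ j - 1 + 1" by simp
  moreover have "2 ^ j = 2 * (2::nat) ^ (j - 1)" using 4(1) by (cases j) auto
  ultimately show ?case unfolding a_seq.simps(4)[OF 4(1)] by simp
qed simp

text \<open>Each full block of length \<open>N\<close> contributes \<open>2 ^ k\<close> to
  \<open>U n p\<close> and leaves \<open>2 ^ k - 1\<close> points, which is one full block for the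
  parameter \<open>2 ^ k - 1\<close>, of value \<open>2 ^ (k - 1)\<close>. The full blocks thus
  balance exactly, and \<open>a_seq_le_double\<close> handles the remainder.\<close>

lemma U_le_double:
  assumes "k \<ge> 1" "2 ^ k \<le> p" "p < 2 ^ (k + 1)" "n \<ge> 1"
  shows "U n p \<le> n" "U n p \<le> 2 * U (n - U n p + 1) (2 ^ k - 1)"
proof -
  define N :: nat where "N = 2 ^ (k + 1) - 1"
  define q r where "q = (n - 1) div N" and "r = (n - 1) mod N + 1"
  have "(1::nat) \<le> 2 ^ k" by simp
  then have "1 \<le> N" unfolding N_def using pow_block_end(1) by (rule le_trans)
  then have r: "1 \<le> r" "r \<le> N" by (simp_all add: r_def Suc_le_eq)
  have n: "n = N * q + r" using assms(4) by (simp add: q_def r_def)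
  have U: "U n p = q * 2 ^ k + a_seq r" using U_eq[OF assms(2,3)] n r by (simp add: N_def)
  have N: "N = 2 ^ k + (2 ^ k - 1)" by (simp add: N_def)
  have nq: "n = q * 2 ^ k + q * (2 ^ k - 1) + r" unfolding n N by (simp add: algebra_simps)
  then show "U n p \<le> n" unfolding U using a_seq_le[of r] by linarith
  have diff: "n - U n p + 1 = (2 ^ k - 1) * q + (r - a_seq r + 1)"
    unfolding U using nq a_seq_le[of r] by (simp add: mult.commute)
  have pk: "2 ^ k = 2 * (2::nat) ^ (k - 1)" using assms(1) by (cases k) auto
  have j: "2 ^ (k - 1) \<le> (2::nat) ^ k - 1" "2 ^ k - 1 < (2::nat) ^ (k - 1 + 1)"
    using assms(1) pow_block_end[of "k - 1"] by simp_all
  show "U n p \<le> 2 * U (n - U n p + 1) (2 ^ k - 1)"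
  proof (cases "r = N")
    case True
    then have ar: "a_seq r = 2 ^ k" using a_seq_pow by (simp add: N_def)
    \<comment> \<open>Here \<open>r - a_seq r + 1 = 2 ^ k\<close> overflows the block length
      \<open>2 ^ k - 1\<close> by one: the quotient rises to \<open>q + 1\<close> and the remainder
      is 1.\<close>
    then have "n - U n p + 1 = (2 ^ k - 1) * (q + 1) + 1"
    proof -
      have "r - a_seq r + 1 = (2 ^ k - 1) + 1" using True ar by (simp add: N)
      then show ?thesis unfolding diff by (simp only: distrib_left mult_1_right add.assoc)
    qed
    then have "U (n - U n p + 1) (2 ^ k - 1) = (q + 1) * 2 ^ (k - 1) + a_seq 1"
      using le_trans[OF one_le_power j(1)] assms(1) by (intro U_eq[OF j]) simp_all
    then show ?thesis using U ar pk by (simp add: algebra_simps)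
  next
    case False
    then have "r + 2 \<le> a_seq r + 2 ^ k" using r a_seq_ge[of r k] by (simp add: N_def)
    then have "U (n - U n p + 1) (2 ^ k - 1) = q * 2 ^ (k - 1) + a_seq (r - a_seq r + 1)"
      using diff assms(1) a_seq_le[of r] by (intro U_eq[OF j]) auto
    then show ?thesis using U a_seq_le_double[OF r(1)] pk by simp
  qed
qed

section \<open>The lower bound by contradiction, and the theorem\<close>

lemma U_le_mu:
  assumes "k \<ge> 1" "2 ^ k \<le> p" "p < 2 ^ (k + 1)"
    and IH: "\<forall>n\<ge>1. U n (2 ^ k - 1) \<le> mu n (2 ^ k - 1)"
    and "n \<ge> 1"
  shows "U n p \<le> mu n p"
proof (rule ccontr)
  assume not_le: "\<not> U n p \<le> mu n p"
  have "p \<ge> 1" using assms(2) by (metis le_trans one_le_numeral one_le_power)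
  then obtain C where C: "covering_code p {..<n} C" "\<And>c. c \<in> C \<Longrightarrow> card c \<le> mu n p"
    using mu_attained by blast
  have "{} \<in> C" and CS: "C \<subseteq> Pow {..<n}" using C(1) by (simp_all add: covering_code_def)
  have fin: "finite (card ` C)" using finite_subset[OF CS] by simp
  moreover have "card ` C \<noteq> {}" using \<open>{} \<in> C\<close> by blast
  ultimately have "Max (card ` C) \<in> card ` C" by (rule Max_in)
  then obtain w where w: "w \<in> C" "card w = Max (card ` C)" by auto
  have w_max: "card c \<le> card w" if "c \<in> C" for c using Max_ge[OF fin] w(2) that by simp
  have less: "card w < U n p" using C(2)[OF w(1)] not_le by simp
  have "w \<subseteq> {..<n}" using w(1) CS by auto
  then have "card ({..<n} - w) = n - card w"
    by (subst card_Diff_subset) (auto intro: finite_subset)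
  \<comment> \<open>\<open>U n p \<le> n\<close> rules out truncation in the subtraction.\<close>
  moreover have "n - U n p + 1 \<le> n - card w"
    using less U_le_double(1)[OF assms(1-3,5)] by linarith
  ultimately obtain T where T: "T \<subseteq> {..<n} - w" "card T = n - U n p + 1"
    by (metis obtain_subset_with_card_n)
  have "p div 2 \<le> 2 ^ k - 1" using assms(3) by simp
  then have "mu (n - U n p + 1) (2 ^ k - 1) \<le> card w div 2"
    using mu_disjoint_max_word[OF _ C(1) w(1) w_max T(1)] T(2) by simp
  moreover have "U (n - U n p + 1) (2 ^ k - 1) \<le> mu (n - U n p + 1) (2 ^ k - 1)" using IH by simp
  \<comment> \<open>The chain is
    \<open>U n p \<le> 2 * (card w div 2) \<le> card w < U n p\<close>.\<close>
  ultimately show False using U_le_double(2)[OF assms(1-3,5)] less by linarith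
qed

theorem theorem5p2:
  fixes k m :: nat
  assumes "k \<ge> 1"
    and "m = 2 ^ k"
    and "\<forall>n\<ge>1. mu n (m - 1) = U n (m - 1)"
  shows "(\<forall>p\<in>{m, m + 1}. \<forall>n\<ge>1. mu n p = U n p) \<and> (\<forall>n\<ge>1. mu n m = mu n (m + 1))"
proof -
  have k2: "2 \<le> (2::nat) ^ k" using power_increasing[OF assms(1), of "2::nat"] by simp
  have mu_eq: "mu n p = U n p" if "p \<in> {m, m + 1}" "n \<ge> 1" for n p
  proof (rule antisym)
    show "mu n p \<le> U n p" using mu_le_U that assms(2) by auto
    show "U n p \<le> mu n p"
      using that assms k2 by (intro U_le_mu[OF assms(1)]) auto
  qed
  \<comment> \<open>\<open>U\<close> sees its second argument only through \<open>floor_log\<close>,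
    and \<open>m \<ge> 2\<close> gives \<open>m + 1 < 2 * m\<close>.\<close>
  moreover have "U n m = U n (m + 1)" for n
  proof -
    have "floor_log m = k" by (simp add: assms(2))
    moreover have "floor_log (m + 1) = k"
      using k2 floor_log_exp2_le[of "m + 1"] floor_log_exp2_gt[of "m + 1"]
      by (intro pow_block_unique[of _ "m + 1"]) (auto simp: assms(2))
    ultimately show ?thesis by (simp add: U_def)
  qed
  ultimately show ?thesis by simp
qed

end
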